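(* Let $L:\Theta\to\mathbb{R}$, maps $T_1,\dots,T_k:\Theta\to\Theta$, a starting value $\theta_0\in\Theta$, the compact set $\Theta_0=\{\theta\in\Theta\mid L(\theta)\ge L(\theta_0)\}$, and the sequence $(\theta_n)_{n\in\mathbb{N}}$ given by $\theta_{n+1}=T_k\cdots T_1(\theta_n)$, $n\ge0$, be as in the iterative partial maximization setting described in the context, and let $\mathcal{A}_\infty$ be the set of accumulation points of $(\theta_n)_{n\in\mathbb{N}}$. If $\mathcal{A}_\infty$ is finite, then $\mathcal{A}_\infty=\{\theta^*\}$ for some $\theta^*\in\Theta_0$ and the sequence $(\theta_n)_{n\in\mathbb{N}}$ converges to $\theta^*$.
   Context: Iterative partial maximization setting. $\Theta\subseteq\mathbb{R}^d$ is an open set and $L:\Theta\to\mathbb{R}$ is a differentiable function. The point $\theta_0\in\Theta$ is such that $\Theta_0=\{\theta\in\Theta\mid L(\theta)\ge L(\theta_0)\}$ is compact. For functions $g_i:\Theta\to\mathbb{R}^{d_i}$, $i=1,\dots,k$, and $\theta^*\in\Theta$, define the sections $$\Theta_i(\theta^* )=\{\theta\in\Theta\mid g_i(\theta)=g_i(\theta^* )\}.$$ Assume: (i) for all $\theta^*\in\Theta$ and $i=1,\dots,k$, the maximum of $L$ over $\Theta_i(\theta^* )$ is uniquely attained, and the associated map $T_i:\Theta\to\Theta$, $T_i(\theta^* )=\mathop{\mathrm{argmax}}_{\theta\in\Theta_i(\theta^* )}L(\theta)$, is continuous for every $i=1,\dots,k$; (ii) if $\theta^*\in\Theta$ maximizes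 $L$ over all sections $\Theta_i(\theta^* )$, $i=1,\dots,k$ (equivalently $\theta^*=T_i(\theta^* )$ for all $i$), then $\theta^*$ solves the likelihood equations $\frac{\partial L(\theta)}{\partial\theta}\big|_{\theta=\theta^*}=0$. The sequence is defined by $\theta_{n+1}=T_k\cdots T_1(\theta_n)$ (composition of maps) for $n\ge0$, starting at $\theta_0$. An accumulation point of the sequence is a limit of a convergent subsequence; since $\theta_n\in\Theta_0$ for all $n$ and $\Theta_0$ is compact, $\mathcal{A}_\infty\subseteq\Theta_0$. *)

theory Defs
  imports "HOL-Analysis.Analysis"
begin

definition level_section :: "'a set \<Rightarrow> ('a \<Rightarrow> 'b) \<Rightarrow> 'a \<Rightarrow> 'a set" where
  "level_section \<Theta> h \<theta>' = {\<theta> \<in> \<Theta>. h \<theta> = h \<theta>'}"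

text \<open>
  Partial maximization of \<open>L\<close> over the section through \<open>\<theta>'\<close>. The value is meaningful only where
  the maximizer exists; it is determined only where the maximizer is unique.
\<close>

definition partial_max :: "'a set \<Rightarrow> ('a \<Rightarrow> real) \<Rightarrow> ('a \<Rightarrow> 'b) \<Rightarrow> 'a \<Rightarrow> 'a" where
  "partial_max \<Theta> L h \<theta>' = arg_max_on L (level_section \<Theta> h \<theta>')"

text \<open>
  \<open>ipm_step \<Theta> L g k\<close> is the composition \<open>T k \<circ> \<dots> \<circ> T 1\<close> with
  \<open>T i = partial_max \<Theta> L (g i)\<close>: \<open>fold\<close> applies \<open>T 1\<close> first.
\<close>

definition ipm_step :: "'a set \<Rightarrow> ('a \<Rightarrow> real) \<Rightarrow> (nat \<Rightarrow> 'a \<Rightarrow> 'b) \<Rightarrow> nat \<Rightarrow> 'a \<Rightarrow> 'a" where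
  "ipm_step \<Theta> L g k = fold (\<lambda>i. partial_max \<Theta> L (g i)) [1..<Suc k]"

primrec ipm_seq ::
  "'a set \<Rightarrow> ('a \<Rightarrow> real) \<Rightarrow> (nat \<Rightarrow> 'a \<Rightarrow> 'b) \<Rightarrow> nat \<Rightarrow> 'a \<Rightarrow> nat \<Rightarrow> 'a" where
  "ipm_seq \<Theta> L g k \<theta>0 0 = \<theta>0"
| "ipm_seq \<Theta> L g k \<theta>0 (Suc n) = ipm_step \<Theta> L g k (ipm_seq \<Theta> L g k \<theta>0 n)"

definition accumulation_points :: "(nat \<Rightarrow> 'a::topological_space) \<Rightarrow> 'a set" where
  "accumulation_points X = {x. \<exists>r. strict_mono r \<and> (X \<circ> r) \<longlonglongrightarrow> x}"

end

theory Submission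
  imports Defs
begin

text \<open>
  Every \<open>T\<^sub>i\<close> increases \<open>L\<close> weakly, and because the maximizer on a section is unique, it leaves
  \<open>L\<close> unchanged only at its fixed points. Both properties and continuity pass to the composition
  \<open>T = T\<^sub>k \<circ> \<dots> \<circ> T\<^sub>1\<close> (\<open>strict_ascent_on_fold\<close>). Along the sequence \<open>L\<close> therefore increases
  to a limit, and by continuity \<open>L\<close> takes this limit as its value at every accumulation point. If \<open>a\<close> is an
  accumulation point, so is \<open>T a\<close>; hence \<open>L (T a) = L a\<close>, and so \<open>T a = a\<close>
  (\<open>strict_ascent_accumulation_point_fixed\<close>).

  When the accumulation points are finitely many, each of them is isolated from the others. If the
  sequence did not converge to such a point \<open>a\<close>, it would enter and leave small balls around \<open>a\<close>
  infinitely often. Since \<open>T a = a\<close> and \<open>T\<close> is continuous, each exit from a very small ball lands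
  in an annulus around \<open>a\<close> that contains no accumulation point, contradicting compactness
  (\<open>convergent_to_isolated_fixed_accumulation_point\<close>).
\<close>

section \<open>Accumulation points in compact sets\<close>

lemma accumulation_points_in_closed:
  assumes "closed K" "\<And>n. X n \<in> K"
  shows "accumulation_points X \<subseteq> K"
proof
  fix x assume "x \<in> accumulation_points X"
  then obtain r where "(X \<circ> r) \<longlonglongrightarrow> x"
    by (auto simp: accumulation_points_def)
  then show "x \<in> K"
    using closed_sequentially[OF assms(1), of "X \<circ> r" x] assms(2) by simp
qed

lemma accumulation_point_in_compact:
  fixes X :: "nat \<Rightarrow> 'a::metric_space"
  assumes "compact C" "infinite {n. X n \<in> C}"
  shows "accumulation_points X \<inter> C \<noteq> {}"
proof -
  obtain r :: "nat \<Rightarrow> nat" where r: "strict_mono r" "\<And>n. X (r n) \<in> C"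
    using infinite_enumerate[OF assms(2)] by auto
  obtain l s where "l \<in> C" "strict_mono s" "((X \<circ> r) \<circ> s) \<longlonglongrightarrow> l"
    using seq_compactE[of C "X \<circ> r"] assms(1) r(2)
    by (auto simp: compact_eq_seq_compact_metric)
  moreover have "strict_mono (r \<circ> s)"
    using r(1) \<open>strict_mono s\<close> by (rule strict_mono_o)
  ultimately show ?thesis
    unfolding accumulation_points_def by (auto simp: comp_assoc)
qed

lemma accumulation_point_frequently:
  assumes "a \<in> accumulation_points X" "open U" "a \<in> U"
  shows "\<exists>n\<ge>N. X n \<in> U"
proof -
  obtain r where r: "strict_mono r" "(X \<circ> r) \<longlonglongrightarrow> a"
    using assms(1) by (auto simp: accumulation_points_def)
  have "\<forall>\<^sub>F n in sequentially. X (r n) \<in> U"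
    using topological_tendstoD[OF r(2) assms(2,3)] by simp
  then obtain M where "\<And>n. n \<ge> M \<Longrightarrow> X (r n) \<in> U"
    by (auto simp: eventually_sequentially)
  then have "X (r (max M N)) \<in> U" by simp
  moreover have "r (max M N) \<ge> N"
    using seq_suble[OF r(1), of "max M N"] by linarith
  ultimately show ?thesis by blast
qed

text \<open>
  The orbit of a continuous map cannot jump out of a neighbourhood of a fixed point: an exit from a
  small enough ball lands close to it. If no other accumulation point is nearby, exits happen only
  finitely often, so the orbit is eventually trapped.
\<close>

lemma convergent_to_isolated_fixed_accumulation_point:
  fixes X :: "nat \<Rightarrow> 'a::metric_space"
  assumes K: "compact K" "\<And>n. X n \<in> K"
    and step: "\<And>n. X (Suc n) = T (X n)"
    and cont: "continuous_on K T"
    and a: "a \<in> accumulation_points X" "T a = a"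
    and e: "e > 0" "accumulation_points X \<inter> ball a e \<subseteq> {a}"
  shows "X \<longlonglongrightarrow> a"
proof -
  have "a \<in> K"
    using accumulation_points_in_closed[of K X] K a(1) by (auto simp: compact_imp_closed)
  obtain \<delta> where \<delta>: "\<delta> > 0" "\<And>x. x \<in> K \<Longrightarrow> dist x a < \<delta> \<Longrightarrow> dist (T x) a < e / 2"
    using cont \<open>a \<in> K\<close> e(1) a(2) unfolding continuous_on_iff by (metis half_gt_zero)
  have trapped: "\<exists>N. \<forall>n\<ge>N. dist (X n) a < d" if d: "0 < d" "d \<le> \<delta>" for d
  proof -
    \<comment> \<open>Every exit from \<open>ball a d\<close> lands in this annulus. The outer radius \<open>e / 2\<close> lets the annulus
      be closed and still lie inside the isolating ball of radius \<open>e\<close>.\<close>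
    define C where "C = K \<inter> (cball a (e / 2) - ball a d)"
    have "compact C"
      unfolding C_def using K(1)
      by (intro compact_Int_closed closed_Diff) auto
    moreover have "accumulation_points X \<inter> C = {}"
      using e d(1) by (auto simp: C_def subset_iff)
    ultimately have "finite {n. X n \<in> C}"
      using accumulation_point_in_compact by blast
    then obtain M where M: "\<And>n. n \<ge> M \<Longrightarrow> X n \<notin> C"
      unfolding finite_nat_set_iff_bounded by (metis mem_Collect_eq not_less)
    obtain N where N: "N \<ge> M" "X N \<in> ball a d"
      using accumulation_point_frequently[OF a(1), of "ball a d" M] d(1) by auto
    have "dist (X n) a < d" if "n \<ge> N" for n
      using that
    proof (induction n rule: dec_induct)
      case base
      then show ?case using N(2) by (simp add: dist_commute)
    next
      case (step n)
      have "dist (X (Suc n)) a < e / 2"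
        using \<delta>(2)[OF K(2)[of n]] step.IH d(2) assms(3) by simp
      moreover have "X (Suc n) \<notin> C"
        using M step.hyps N(1) by simp
      ultimately show ?case
        using K(2)[of "Suc n"] by (auto simp: C_def dist_commute)
    qed
    then show ?thesis by blast
  qed
  show ?thesis
    unfolding lim_sequentially
  proof (intro allI impI)
    fix r :: real assume "r > 0"
    then obtain N where "\<forall>n\<ge>N. dist (X n) a < min r \<delta>"
      using trapped[of "min r \<delta>"] \<delta>(1) by auto
    then show "\<exists>N. \<forall>n\<ge>N. dist (X n) a < r" by auto
  qed
qed

section \<open>Strict ascent maps\<close>

text \<open>
  \<open>L\<close> is a strict Lyapunov function for the dynamics of \<open>T\<close>, with the sign reversed.
\<close>

definition strict_ascent_on :: "'a::topological_space set \<Rightarrow> ('a \<Rightarrow> real) \<Rightarrow> ('a \<Rightarrow> 'a) \<Rightarrow> bool" where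
  "strict_ascent_on S L T \<longleftrightarrow>
     T \<in> S \<rightarrow> S \<and> continuous_on S T \<and> (\<forall>x\<in>S. L x \<le> L (T x) \<and> (L (T x) = L x \<longrightarrow> T x = x))"

lemma strict_ascent_onD:
  assumes "strict_ascent_on S L T"
  shows "T ` S \<subseteq> S" "continuous_on S T"
    and "x \<in> S \<Longrightarrow> T x \<in> S" "x \<in> S \<Longrightarrow> L x \<le> L (T x)"
    and "x \<in> S \<Longrightarrow> L (T x) = L x \<Longrightarrow> T x = x"
  using assms unfolding strict_ascent_on_def by blast+

text \<open>
  Equality of \<open>L\<close> at the two ends of a composition forces equality across each factor, so that
  each factor fixes the point.
\<close>

lemma strict_ascent_on_compose:
  assumes "strict_ascent_on S L T" "strict_ascent_on S L U"
  shows "strict_ascent_on S L (U \<circ> T)"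
  unfolding strict_ascent_on_def
proof (intro conjI ballI)
  show "U \<circ> T \<in> S \<rightarrow> S"
    using assms[THEN strict_ascent_onD(3)] by simp
  show "continuous_on S (U \<circ> T)"
    using strict_ascent_onD(1,2)[OF assms(1)] strict_ascent_onD(2)[OF assms(2)]
    by (blast intro: continuous_on_compose continuous_on_subset)
next
  fix x assume "x \<in> S"
  then have x: "L x \<le> L (T x)" "L (T x) = L x \<longrightarrow> T x = x" "T x \<in> S"
    using strict_ascent_onD[OF assms(1)] by blast+
  then have Tx: "L (T x) \<le> L (U (T x))" "L (U (T x)) = L (T x) \<longrightarrow> U (T x) = T x"
    using strict_ascent_onD[OF assms(2)] by blast+
  show "L x \<le> L ((U \<circ> T) x)" using x(1) Tx(1) by simp
  show "L ((U \<circ> T) x) = L x \<longrightarrow> (U \<circ> T) x = x" using x Tx by auto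
qed

lemma strict_ascent_on_fold:
  assumes "\<And>i. i \<in> set is \<Longrightarrow> strict_ascent_on S L (T i)"
  shows "strict_ascent_on S L (fold T is)"
  using assms
proof (induction "is")
  case Nil
  then show ?case by (simp add: strict_ascent_on_def)
next
  case (Cons i "is")
  then show ?case using strict_ascent_on_compose[of S L "T i" "fold T is"]
    by (simp add: comp_def)
qed

text \<open>
  \<open>a\<close> and \<open>T a\<close> are limits of the subsequences \<open>X (r n)\<close> and \<open>X (r n + 1)\<close>. The monotone sequence
  \<open>L (X n)\<close> has the same limit along both, so that \<open>T\<close> does not increase \<open>L\<close> at \<open>a\<close>.
\<close>

lemma strict_ascent_accumulation_point_fixed:
  assumes T: "strict_ascent_on S L T" and L: "continuous_on S L"
    and X: "\<And>n. X n \<in> S" "\<And>n. X (Suc n) = T (X n)"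
    and a: "a \<in> accumulation_points X" "a \<in> S"
  shows "T a = a"
proof -
  obtain r where r: "strict_mono r" "(X \<circ> r) \<longlonglongrightarrow> a"
    using a(1) by (auto simp: accumulation_points_def)
  have Ta: "T a \<in> S" and contT: "continuous_on S T"
    and fixed: "L (T a) = L a \<Longrightarrow> T a = a"
    using strict_ascent_onD[OF T] a(2) by blast+
  have "incseq (\<lambda>n. L (X n))"
    using strict_ascent_onD(4)[OF T] X by (intro incseq_SucI) simp
  have lim0: "(\<lambda>n. L (X (r n))) \<longlonglongrightarrow> L a"
    using continuous_on_tendsto_compose[OF L r(2) a(2)] X(1) by simp
  have "(\<lambda>n. X (Suc (r n))) \<longlonglongrightarrow> T a"
    using continuous_on_tendsto_compose[OF contT r(2) a(2)] X by simp
  from continuous_on_tendsto_compose[OF L this Ta]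
  have lim1: "(\<lambda>n. L (X (Suc (r n)))) \<longlonglongrightarrow> L (T a)"
    using X(1) by simp
  \<comment> \<open>\<open>Suc (r n) \<le> r (Suc n)\<close> bounds the shifted values by later values along \<open>r\<close> itself.\<close>
  have "L (X (Suc (r n))) \<le> L (X (r (Suc n)))" for n
    using incseqD[OF \<open>incseq (\<lambda>n. L (X n))\<close> Suc_leI[OF strict_monoD[OF r(1) lessI]]] .
  then have "L (T a) \<le> L a"
    by (intro LIMSEQ_le[OF lim1 LIMSEQ_Suc[OF lim0]]) auto
  moreover have "L a \<le> L (T a)"
    using strict_ascent_onD(4)[OF T a(2)] .
  ultimately show ?thesis using fixed by simp
qed

text \<open>
  The orbit stays in the compact superlevel set of its starting point, so it has an accumulation
  point. That point is fixed by \<open>T\<close>, and finiteness isolates it.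
\<close>

theorem strict_ascent_finite_accumulation_converges:
  fixes X :: "nat \<Rightarrow> 'a::metric_space"
  assumes T: "strict_ascent_on S L T" and L: "continuous_on S L"
    and X: "X 0 \<in> S" "\<And>n. X (Suc n) = T (X n)"
    and K: "compact {x \<in> S. L x \<ge> L (X 0)}"
    and fin: "finite (accumulation_points X)"
  shows "\<exists>a \<in> {x \<in> S. L x \<ge> L (X 0)}. accumulation_points X = {a} \<and> X \<longlonglongrightarrow> a"
proof -
  define K where "K = {x \<in> S. L x \<ge> L (X 0)}"
  have XK: "X n \<in> K" for n
  proof (induction n)
    case 0
    show ?case using X(1) by (simp add: K_def)
  next
    case (Suc n)
    then have "T (X n) \<in> S" "L (X n) \<le> L (T (X n))"
      using strict_ascent_onD(3,4)[OF T] by (auto simp: K_def)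
    then show ?case using Suc X(2) by (auto simp: K_def)
  qed
  have "compact K" using K by (simp add: K_def)
  have AK: "accumulation_points X \<subseteq> K"
    using accumulation_points_in_closed[of K X] \<open>compact K\<close> XK by (simp add: compact_imp_closed)
  obtain a where a: "a \<in> accumulation_points X"
    using accumulation_point_in_compact[OF \<open>compact K\<close>, of X] XK by auto
  have "a \<in> S" using a AK by (auto simp: K_def)
  have "T a = a"
    by (rule strict_ascent_accumulation_point_fixed[OF T L _ X(2) a \<open>a \<in> S\<close>])
      (use XK in \<open>auto simp: K_def\<close>)
  obtain e where e: "e > 0" "\<forall>x\<in>accumulation_points X. x \<noteq> a \<longrightarrow> e \<le> dist a x"
    using finite_set_avoid[OF fin, of a] by auto
  have "continuous_on K T"
    using strict_ascent_onD(2)[OF T] by (rule continuous_on_subset) (auto simp: K_def)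
  moreover have "accumulation_points X \<inter> ball a e \<subseteq> {a}"
    using e(2) by force
  ultimately have lim: "X \<longlonglongrightarrow> a"
    using convergent_to_isolated_fixed_accumulation_point[of K X T a e] \<open>compact K\<close> XK X(2)
      a \<open>T a = a\<close> e(1) by blast
  have "x = a" if "x \<in> accumulation_points X" for x
    using that LIMSEQ_subseq_LIMSEQ[OF lim] LIMSEQ_unique
    unfolding accumulation_points_def by blast
  then have "accumulation_points X = {a}"
    using a by blast
  then show ?thesis using a AK lim by (auto simp: K_def)
qed

section \<open>Iterative partial maximization\<close>

lemma is_arg_max_partial_max:
  assumes "\<exists>\<theta>. is_arg_max L (\<lambda>\<theta>. \<theta> \<in> level_section \<Theta> h \<theta>') \<theta>"
  shows "is_arg_max L (\<lambda>\<theta>. \<theta> \<in> level_section \<Theta> h \<theta>') (partial_max \<Theta> L h \<theta>')"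
  using someI_ex[OF assms] by (simp add: partial_max_def arg_max_on_def arg_max_def)

text \<open>
  A point lies in its own section. If maximizing over that section does not raise \<open>L\<close>, the point
  is already a maximizer, hence the only one.
\<close>

lemma strict_ascent_on_partial_max:
  assumes ex1: "\<And>\<theta>'. \<theta>' \<in> \<Theta> \<Longrightarrow> \<exists>!\<theta>. is_arg_max L (\<lambda>\<theta>. \<theta> \<in> level_section \<Theta> h \<theta>') \<theta>"
    and "continuous_on \<Theta> (partial_max \<Theta> L h)"
  shows "strict_ascent_on \<Theta> L (partial_max \<Theta> L h)"
proof -
  have "partial_max \<Theta> L h x \<in> \<Theta> \<and> L x \<le> L (partial_max \<Theta> L h x) \<and>
      (L (partial_max \<Theta> L h x) = L x \<longrightarrow> partial_max \<Theta> L h x = x)" if x: "x \<in> \<Theta>" for x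
  proof -
    let ?max = "is_arg_max L (\<lambda>\<theta>. \<theta> \<in> level_section \<Theta> h x)"
    have self: "x \<in> level_section \<Theta> h x" using x by (simp add: level_section_def)
    have max: "?max (partial_max \<Theta> L h x)"
      using ex1[OF x] by (rule is_arg_max_partial_max[OF ex1_implies_ex])
    then have "partial_max \<Theta> L h x \<in> \<Theta>" "L x \<le> L (partial_max \<Theta> L h x)"
      using self by (auto simp: is_arg_max_linorder level_section_def)
    moreover have "partial_max \<Theta> L h x = x" if "L (partial_max \<Theta> L h x) = L x"
    proof (rule ex1E[OF ex1[OF x]])
      have "?max x"
        using max self that by (simp add: is_arg_max_linorder)
      fix m assume "\<forall>y. ?max y \<longrightarrow> y = m"
      then have "partial_max \<Theta> L h x = m" "x = m"
        using max \<open>?max x\<close> by iprover+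
      then show ?thesis by simp
    qed
    ultimately show ?thesis by iprover
  qed
  then show ?thesis using assms(2) unfolding strict_ascent_on_def by blast
qed

theorem corollary1:
  fixes \<Theta> :: "(real ^ 'd) set"
    and L :: "real ^ 'd \<Rightarrow> real"
    and k :: nat
    and dims :: "nat \<Rightarrow> nat"
    and g :: "nat \<Rightarrow> real ^ 'd \<Rightarrow> real list"
    and \<theta>0 :: "real ^ 'd"
  assumes "open \<Theta>"
    and "L differentiable_on \<Theta>"
    and "\<theta>0 \<in> \<Theta>"
    and "compact {\<theta> \<in> \<Theta>. L \<theta> \<ge> L \<theta>0}"
    (* the i-th map takes values in R^(dims i), encoded as the lists of length dims i *)
    and "\<And>i \<theta>. i \<in> {1..k} \<Longrightarrow> \<theta> \<in> \<Theta> \<Longrightarrow> length (g i \<theta>) = dims i"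
    and "\<And>i \<theta>'. i \<in> {1..k} \<Longrightarrow> \<theta>' \<in> \<Theta> \<Longrightarrow>
           \<exists>!\<theta>. is_arg_max L (\<lambda>\<theta>. \<theta> \<in> level_section \<Theta> (g i) \<theta>') \<theta>"
    and "\<And>i. i \<in> {1..k} \<Longrightarrow> continuous_on \<Theta> (partial_max \<Theta> L (g i))"
    and "\<And>\<theta>'. \<theta>' \<in> \<Theta> \<Longrightarrow>
           (\<forall>i\<in>{1..k}. is_arg_max L (\<lambda>\<theta>. \<theta> \<in> level_section \<Theta> (g i) \<theta>') \<theta>') \<Longrightarrow>
           (L has_derivative (\<lambda>_. 0)) (at \<theta>')"
    and "finite (accumulation_points (ipm_seq \<Theta> L g k \<theta>0))"
  shows "\<exists>\<theta>' \<in> {\<theta> \<in> \<Theta>. L \<theta> \<ge> L \<theta>0}.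
           accumulation_points (ipm_seq \<Theta> L g k \<theta>0) = {\<theta>'} \<and>
           ipm_seq \<Theta> L g k \<theta>0 \<longlonglongrightarrow> \<theta>'"
proof -
  have "strict_ascent_on \<Theta> L (partial_max \<Theta> L (g i))" if "i \<in> {1..k}" for i
    using assms(6)[OF that] assms(7)[OF that] by (rule strict_ascent_on_partial_max)
  then have "strict_ascent_on \<Theta> L (ipm_step \<Theta> L g k)"
    unfolding ipm_step_def by (intro strict_ascent_on_fold) auto
  moreover have "continuous_on \<Theta> L"
    using assms(2) by (rule differentiable_imp_continuous_on)
  ultimately show ?thesis
    using strict_ascent_finite_accumulation_converges
      [of \<Theta> L "ipm_step \<Theta> L g k" "ipm_seq \<Theta> L g k \<theta>0"] assms(3,4,9)
    by simp
qed

end
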